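(* Let $k$ be an $F$-finite field of characteristic $p>0$, $n>2$, $d>2$, and let $B\subseteq\mathbb{N}^n$ be the semigroup generated by a set $U$ with $\{\mathbf{m}\in T_{n,d}:\max(\mathbf{m})\ge d-1\}\subseteq U\subseteq T_{n,d}$. Then \[\operatorname{Fte}(k[B])\le n\left\lceil \log_p\big((n-1)(d^2-d)\big)\right\rceil.\]
   Context: $T_{n,d}=\{\mathbf{a}\in\mathbb{N}^n:\sum a_i=d\}$, $\max(\mathbf{a})=\max_i a_i$. $k[B]\subseteq k[x_1,\dots,x_n]$ is the $k$-subalgebra generated by monomials with exponent vectors in $U$, graded with homogeneous maximal ideal. For an ideal $I$, $I^{[p^e]}$ is generated by $p^e$-th powers of elements of $I$ and $I^F=\{x: x^{p^e}\in I^{[p^e]}\text{ for some } e\}$. For an ideal $\mathfrak{q}$ generated by a full homogeneous system of parameters, $\operatorname{Fte}(\mathfrak{q})$ is the least $e$ with $(\mathfrak{q}^F)^{[p^e]}=\mathfrak{q}^{[p^e]}$; $\operatorname{Fte}(R)$ is the supremum of $\operatorname{Fte}(\mathfrak{q})$ over all such $\mathfrak{q}$. *)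

theory Defs
  imports Complex_Main "HOL-Computational_Algebra.Primes" "HOL-Library.Poly_Mapping" "HOL-Library.Extended_Nat"
begin

definition subring_of :: "'r::comm_ring_1 set \<Rightarrow> bool" where
  "subring_of R \<longleftrightarrow> 0 \<in> R \<and> 1 \<in> R \<and>
     (\<forall>x\<in>R. \<forall>y\<in>R. x + y \<in> R \<and> x - y \<in> R \<and> x * y \<in> R)"

definition ideal_in :: "'r::comm_ring_1 set \<Rightarrow> 'r set \<Rightarrow> bool" where
  "ideal_in R I \<longleftrightarrow> I \<subseteq> R \<and> 0 \<in> I \<and> (\<forall>x\<in>I. \<forall>y\<in>I. x + y \<in> I) \<and>
     (\<forall>r\<in>R. \<forall>x\<in>I. r * x \<in> I)"

definition ideal_gen :: "'r::comm_ring_1 set \<Rightarrow> 'r set \<Rightarrow> 'r set" where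
  "ideal_gen R G = \<Inter>{I. ideal_in R I \<and> G \<subseteq> I}"

definition frob_bracket :: "'r::comm_ring_1 set \<Rightarrow> nat \<Rightarrow> nat \<Rightarrow> 'r set \<Rightarrow> 'r set" where
  "frob_bracket R p e I = ideal_gen R ((\<lambda>x. x ^ (p ^ e)) ` I)"

definition frob_closure :: "'r::comm_ring_1 set \<Rightarrow> nat \<Rightarrow> 'r set \<Rightarrow> 'r set" where
  "frob_closure R p I = {x \<in> R. \<exists>e. x ^ (p ^ e) \<in> frob_bracket R p e I}"

definition prime_ideal_in :: "'r::comm_ring_1 set \<Rightarrow> 'r set \<Rightarrow> bool" where
  "prime_ideal_in R P \<longleftrightarrow> ideal_in R P \<and> P \<noteq> R \<and>
     (\<forall>a\<in>R. \<forall>b\<in>R. a * b \<in> P \<longrightarrow> a \<in> P \<or> b \<in> P)"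

definition krull_dim :: "'r::comm_ring_1 set \<Rightarrow> enat" where
  "krull_dim R = Sup {enat l | l. \<exists>Ps :: nat \<Rightarrow> 'r set.
      (\<forall>i\<le>l. prime_ideal_in R (Ps i)) \<and> (\<forall>i<l. Ps i \<subset> Ps (Suc i))}"

definition F_finite :: "nat \<Rightarrow> 'k::field itself \<Rightarrow> bool" where
  "F_finite p _ \<longleftrightarrow> (\<exists>S :: 'k set. finite S \<and>
      (\<forall>x::'k. \<exists>c. x = (\<Sum>s\<in>S. c s ^ p * s)))"

type_synonym 'k mpoly = "(nat \<Rightarrow>\<^sub>0 nat) \<Rightarrow>\<^sub>0 'k"

definition T :: "nat \<Rightarrow> nat \<Rightarrow> (nat \<Rightarrow>\<^sub>0 nat) set" where
  "T n d = {a. Poly_Mapping.keys a \<subseteq> {..<n} \<and> (\<Sum>i<n. Poly_Mapping.lookup a i) = d}"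

definition maxexp :: "nat \<Rightarrow> (nat \<Rightarrow>\<^sub>0 nat) \<Rightarrow> nat" where
  "maxexp n a = Max (Poly_Mapping.lookup a ` {..<n})"

definition monoid_gen :: "(nat \<Rightarrow>\<^sub>0 nat) set \<Rightarrow> (nat \<Rightarrow>\<^sub>0 nat) set" where
  "monoid_gen U = \<Inter>{S. 0 \<in> S \<and> U \<subseteq> S \<and> (\<forall>a\<in>S. \<forall>b\<in>S. a + b \<in> S)}"

definition monomial_algebra :: "(nat \<Rightarrow>\<^sub>0 nat) set \<Rightarrow> 'k::field mpoly set" where
  "monomial_algebra B = \<Inter>{S. subring_of S \<and> (\<forall>c. Poly_Mapping.single 0 c \<in> S) \<and>
      (\<forall>u\<in>B. Poly_Mapping.single u 1 \<in> S)}"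

definition deg :: "(nat \<Rightarrow>\<^sub>0 nat) \<Rightarrow> nat" where
  "deg a = (\<Sum>i\<in>Poly_Mapping.keys a. Poly_Mapping.lookup a i)"

definition homogeneous_pos :: "'k::field mpoly \<Rightarrow> bool" where
  "homogeneous_pos f \<longleftrightarrow> (\<exists>D>0. \<forall>a\<in>Poly_Mapping.keys f. deg a = D)"

text \<open>Homogeneous maximal ideal: elements with zero constant term.\<close>
definition hmax :: "'k::field mpoly set \<Rightarrow> 'k mpoly set" where
  "hmax R = {f \<in> R. Poly_Mapping.lookup f 0 = 0}"

definition full_hsop :: "'k::field mpoly set \<Rightarrow> 'k mpoly list \<Rightarrow> bool" where
  "full_hsop R fs \<longleftrightarrow> set fs \<subseteq> R \<and> (\<forall>f\<in>set fs. homogeneous_pos f) \<and>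
     enat (length fs) = krull_dim R \<and>
     ideal_gen R (set fs) \<subseteq> hmax R \<and>
     (\<forall>x\<in>hmax R. \<exists>N. x ^ N \<in> ideal_gen R (set fs))"

definition Fte_ideal :: "'r::comm_ring_1 set \<Rightarrow> nat \<Rightarrow> 'r set \<Rightarrow> enat" where
  "Fte_ideal R p q =
     (if \<exists>e. frob_bracket R p e (frob_closure R p q) = frob_bracket R p e q
      then enat (LEAST e. frob_bracket R p e (frob_closure R p q) = frob_bracket R p e q)
      else \<infinity>)"

definition Fte :: "'k::field mpoly set \<Rightarrow> nat \<Rightarrow> enat" where
  "Fte R p = Sup {Fte_ideal R p (ideal_gen R (set fs)) | fs. full_hsop R fs}"

end

theory Submission
  imports Defs
begin

text \<open>Let \<open>A\<close> be the monoid of all exponents in \<open>n\<close> variables whose degree is divisible by \<open>d\<close>, so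
  that \<open>k[B] \<subseteq> k[A]\<close>. The ring \<open>k[A]\<close> is a direct summand of a polynomial ring, which is
  F-split; hence every ideal of \<open>k[A]\<close> is Frobenius closed, and an element \<open>x\<close> of the Frobenius
  closure of an ideal \<open>q\<close> of \<open>k[B]\<close> is a combination \<open>\<Sum>i. f i * s i\<close> with \<open>f i \<in> q\<close> and
  \<open>s i \<in> k[A]\<close>. On the other hand \<open>N * A \<subseteq> B\<close> for \<open>N \<ge> (n - 1) * (d - 1)^2\<close>, so for \<open>p^m\<close> of that
  size the powers \<open>s i ^ p^m\<close> lie in \<open>k[B]\<close> and \<open>x ^ p^m\<close> lies in the \<open>m\<close>-th Frobenius power of
  \<open>q\<close>. Thus already the exponent \<open>m\<close>, without the factor \<open>n\<close>, works for every ideal.\<close>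

section \<open>Ideals and Frobenius powers\<close>

lemma ideal_gen_least: "ideal_in R I \<Longrightarrow> G \<subseteq> I \<Longrightarrow> ideal_gen R G \<subseteq> I"
  unfolding ideal_gen_def by blast

lemma ideal_gen_superset: "G \<subseteq> ideal_gen R G"
  unfolding ideal_gen_def by blast

lemma ideal_in_ideal_gen:
  assumes "subring_of R" "G \<subseteq> R"
  shows "ideal_in R (ideal_gen R G)"
proof -
  have "ideal_in R R"
    using assms(1) unfolding subring_of_def ideal_in_def by auto
  then have "ideal_gen R G \<subseteq> R"
    using assms(2) by (rule ideal_gen_least)
  then show ?thesis
    unfolding ideal_gen_def ideal_in_def by blast
qed

lemma subring_of_power: "subring_of R \<Longrightarrow> x \<in> R \<Longrightarrow> x ^ k \<in> R"
  by (induction k) (auto simp: subring_of_def)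

lemma subring_of_sum:
  assumes "subring_of R" "\<And>i. i \<in> S \<Longrightarrow> f i \<in> R"
  shows "sum f S \<in> R"
  using assms(2)
  by (induction S rule: infinite_finite_induct) (use assms(1) in \<open>auto simp: subring_of_def\<close>)

lemma ideal_in_frob_bracket:
  assumes "subring_of R" "I \<subseteq> R"
  shows "ideal_in R (frob_bracket R p e I)"
  unfolding frob_bracket_def
  by (rule ideal_in_ideal_gen) (use assms in \<open>auto intro: subring_of_power\<close>)

text \<open>The map \<open>\<theta>\<close> is a left inverse of the \<open>e\<close>-th Frobenius with values in a larger ring. The
  proof avoids that ring: all \<open>y\<close> with \<open>\<theta> (r * y) ^ p ^ m\<close> in the Frobenius power for every \<open>r \<in> R\<close>
  form an ideal containing the generators of \<open>frob_bracket R p e I\<close>.\<close>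

lemma frob_closure_power_mem:
  fixes R :: "'r::comm_ring_1 set"
  assumes R: "subring_of R" and I: "ideal_in R I"
    and p: "prime p" "CHAR('r) = p"
    and split: "\<And>e. \<exists>\<theta>. (\<forall>x y. \<theta> (x + y) = \<theta> x + \<theta> y) \<and> \<theta> 1 = 1 \<and>
      (\<forall>r\<in>R. \<forall>g. \<theta> (r ^ p ^ e * g) = r * \<theta> g) \<and> (\<forall>g\<in>R. \<theta> g ^ p ^ m \<in> R)"
    and x: "x \<in> frob_closure R p I"
  shows "x ^ p ^ m \<in> frob_bracket R p m I"
proof -
  let ?B = "frob_bracket R p m I"
  from x obtain e where xR: "x \<in> R" and xe: "x ^ p ^ e \<in> frob_bracket R p e I"
    unfolding frob_closure_def by blast
  obtain \<theta> where add: "\<And>x y. \<theta> (x + y) = \<theta> x + \<theta> y" and one: "\<theta> 1 = 1"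
    and lin: "\<And>r g. r \<in> R \<Longrightarrow> \<theta> (r ^ p ^ e * g) = r * \<theta> g"
    and mem: "\<And>g. g \<in> R \<Longrightarrow> \<theta> g ^ p ^ m \<in> R"
    using split[of e] by blast
  have IR: "I \<subseteq> R"
    using I by (simp add: ideal_in_def)
  have B: "ideal_in R ?B"
    using R IR by (rule ideal_in_frob_bracket)
  have zero: "\<theta> 0 = 0"
    using add[of 0 0] by simp
  define J where "J = {y \<in> R. \<forall>r\<in>R. \<theta> (r * y) ^ p ^ m \<in> ?B}"
  have "ideal_in R J"
    unfolding ideal_in_def
  proof (intro conjI ballI)
    show "J \<subseteq> R" by (auto simp: J_def)
    show "0 \<in> J"
      using R B p prime_gt_0_nat[of p]
      by (auto simp: J_def zero subring_of_def ideal_in_def power_0_left)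
  next
    fix y z assume yz: "y \<in> J" "z \<in> J"
    have "\<theta> (r * (y + z)) ^ p ^ m = \<theta> (r * y) ^ p ^ m + \<theta> (r * z) ^ p ^ m" for r
      using p by (simp add: distrib_left add freshmans_dream')
    then show "y + z \<in> J"
      using yz R B by (auto simp: J_def subring_of_def ideal_in_def)
  next
    fix s y assume sy: "s \<in> R" "y \<in> J"
    \<comment> \<open>The factor \<open>s\<close> is absorbed into \<open>r\<close>; this is why
      \<open>J\<close> quantifies over all \<open>r\<close> in \<open>R\<close> and not only over
      \<open>r = 1\<close>.\<close>
    have "\<theta> (r * (s * y)) ^ p ^ m \<in> ?B" if "r \<in> R" for r
    proof -
      have "r * s \<in> R" using R sy that by (simp add: subring_of_def)
      then show ?thesis using sy by (simp add: J_def mult.assoc[symmetric])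
    qed
    then show "s * y \<in> J"
      using sy R by (auto simp: J_def subring_of_def)
  qed
  moreover have "(\<lambda>x. x ^ p ^ e) ` I \<subseteq> J"
  proof
    fix y assume "y \<in> (\<lambda>x. x ^ p ^ e) ` I"
    then obtain f where f: "f \<in> I" "y = f ^ p ^ e" by blast
    have fB: "f ^ p ^ m \<in> ?B"
      unfolding frob_bracket_def using f by (intro subsetD[OF ideal_gen_superset] imageI)
    \<comment> \<open>Here \<open>f\<close> leaves \<open>\<theta>\<close> by linearity. The
      cofactor \<open>\<theta> r\<close> may lie outside \<open>R\<close>, but its
      \<open>p ^ m\<close>-th power is in \<open>R\<close>.\<close>
    have "\<theta> (r * y) ^ p ^ m \<in> ?B" if "r \<in> R" for r
    proof -
      have "\<theta> (r * y) = f * \<theta> r"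
        using lin[of f r] f IR by (auto simp: mult.commute)
      then have "\<theta> (r * y) ^ p ^ m = \<theta> r ^ p ^ m * f ^ p ^ m"
        by (simp add: power_mult_distrib mult.commute)
      then show ?thesis
        using B fB mem[OF that] by (simp add: ideal_in_def)
    qed
    then show "y \<in> J"
      using f IR R by (auto simp: J_def intro: subring_of_power)
  qed
  ultimately have "x ^ p ^ e \<in> J"
    using xe ideal_gen_least unfolding frob_bracket_def by blast
  moreover have "1 \<in> R"
    using R by (simp add: subring_of_def)
  ultimately have "\<theta> (1 * x ^ p ^ e) ^ p ^ m \<in> ?B"
    unfolding J_def by blast
  moreover have "\<theta> (1 * x ^ p ^ e) = x"
    using lin[OF xR, of 1] by (simp add: one)
  ultimately show ?thesis by simp
qed

text \<open>It is enough to compare generators: one inclusion is the hypothesis, the other holds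
  because exponent 0 shows that \<open>I\<close> lies in its Frobenius closure.\<close>

lemma frob_bracket_frob_closure_eq:
  assumes R: "subring_of R" and I: "ideal_in R I"
    and closure: "\<And>x. x \<in> frob_closure R p I \<Longrightarrow> x ^ p ^ m \<in> frob_bracket R p m I"
  shows "frob_bracket R p m (frob_closure R p I) = frob_bracket R p m I"
proof
  have IR: "I \<subseteq> R"
    using I by (simp add: ideal_in_def)
  show "frob_bracket R p m (frob_closure R p I) \<subseteq> frob_bracket R p m I"
    unfolding frob_bracket_def[of R p m "frob_closure R p I"]
    by (rule ideal_gen_least) (use closure ideal_in_frob_bracket[OF R IR] in auto)
  have "I \<subseteq> frob_closure R p I"
  proof
    fix x assume x: "x \<in> I"
    then have "x ^ p ^ 0 \<in> frob_bracket R p 0 I"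
      unfolding frob_bracket_def by (intro subsetD[OF ideal_gen_superset] imageI)
    then show "x \<in> frob_closure R p I"
      using x IR unfolding frob_closure_def by blast
  qed
  then show "frob_bracket R p m I \<subseteq> frob_bracket R p m (frob_closure R p I)"
    unfolding frob_bracket_def ideal_gen_def by blast
qed

section \<open>A Frobenius splitting of the polynomial ring\<close>

text \<open>Let \<open>c\<close> act on the field by multiplication with \<open>c ^ p ^ e\<close>.
  This is a vector space structure in which 1 is independent, so sending 1 to 1 extends to a linear
  map into the field with its usual structure.\<close>

lemma ex_inverse_Frobenius_linear:
  assumes p: "prime p" "CHAR('k::field) = p"
  shows "\<exists>\<rho> :: 'k \<Rightarrow> 'k. (\<forall>x y. \<rho> (x + y) = \<rho> x + \<rho> y) \<and> \<rho> 1 = 1 \<and>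
    (\<forall>c x. \<rho> (c ^ p ^ e * x) = c * \<rho> x)"
proof -
  have s1: "vector_space (\<lambda>c x::'k. c ^ p ^ e * x)"
    using p by unfold_locales (auto simp: algebra_simps power_mult_distrib freshmans_dream')
  have s2: "vector_space (\<lambda>c x::'k. c * x)"
    by unfold_locales (auto simp: algebra_simps)
  interpret vector_space_pair "\<lambda>c x::'k. c ^ p ^ e * x" "\<lambda>c x::'k. c * x"
    using s1 s2 by (simp add: vector_space_pair_def)
  have "vs1.independent {1}" by simp
  from linear_independent_extend[OF this, of "\<lambda>x. x"] obtain \<rho>
    where "Vector_Spaces.linear (\<lambda>c x::'k. c ^ p ^ e * x) (*) \<rho>" "\<rho> 1 = 1" by auto
  then show ?thesis
    unfolding Vector_Spaces.linear_iff by blast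
qed

text \<open>Exponent vectors multiply by convolution over the index monoid \<open>nat\<close>, where \<open>of_nat q\<close> is
  concentrated in \<open>0\<close>; so \<open>of_nat q * a\<close> is the scalar multiple.\<close>

lemma lookup_of_nat_times [simp]:
  "Poly_Mapping.lookup (of_nat q * (a :: nat \<Rightarrow>\<^sub>0 nat)) i = q * Poly_Mapping.lookup a i"
  by (induction q) (simp_all add: distrib_right lookup_add)

lemma single_power:
  "Poly_Mapping.single (a :: nat \<Rightarrow>\<^sub>0 nat) (c :: 'k::comm_semiring_1) ^ q
    = Poly_Mapping.single (of_nat q * a) (c ^ q)"
  by (induction q) (simp_all add: mult_single distrib_right)

lemma poly_mapping_eq_sum_single:
  "f = (\<Sum>a\<in>Poly_Mapping.keys f. Poly_Mapping.single a (Poly_Mapping.lookup f a))"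
proof (rule poly_mapping_eqI)
  fix b
  show "Poly_Mapping.lookup f b = Poly_Mapping.lookup (\<Sum>a\<in>Poly_Mapping.keys f.
      Poly_Mapping.single a (Poly_Mapping.lookup f a)) b"
    by (simp add: lookup_sum lookup_single when_def in_keys_iff)
qed

lemma CHAR_mpoly: "CHAR('k::comm_ring_1 mpoly) = CHAR('k)"
proof (rule CHAR_eqI)
  show "of_nat CHAR('k) = (0 :: 'k mpoly)"
    by (simp flip: single_of_nat)
  fix x assume "of_nat x = (0 :: 'k mpoly)"
  then have "Poly_Mapping.lookup (of_nat x :: 'k mpoly) 0 = 0" by simp
  then show "CHAR('k) dvd x"
    by (simp add: lookup_of_nat of_nat_eq_0_iff_char_dvd)
qed

lemma mpoly_power_Frobenius:
  fixes f :: "'k::field mpoly"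
  assumes "prime p" "CHAR('k) = p"
  shows "f ^ p ^ e = (\<Sum>a\<in>Poly_Mapping.keys f.
    Poly_Mapping.single (of_nat (p ^ e) * a) (Poly_Mapping.lookup f a ^ p ^ e))"
proof -
  have "(\<Sum>a\<in>Poly_Mapping.keys f. Poly_Mapping.single a (Poly_Mapping.lookup f a)) ^ p ^ e
    = (\<Sum>a\<in>Poly_Mapping.keys f. Poly_Mapping.single a (Poly_Mapping.lookup f a) ^ p ^ e)"
    by (rule freshmans_dream_sum') (use assms in \<open>simp_all add: CHAR_mpoly\<close>)
  then show ?thesis
    by (simp only: poly_mapping_eq_sum_single[symmetric] single_power)
qed

text \<open>Take the coefficients at exponents \<open>q * b\<close> with \<open>b \<in> A\<close>, apply \<open>\<rho>\<close>, and move them to \<open>b\<close>: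
  this combines the F-splitting with the projection onto \<open>k[A]\<close>.\<close>

lemma ex_Frobenius_splitting:
  fixes A :: "(nat \<Rightarrow>\<^sub>0 nat) set"
  assumes p: "prime p" "CHAR('k::field) = p"
    and zero: "0 \<in> A" and full: "\<And>a b. a \<in> A \<Longrightarrow> a + b \<in> A \<longleftrightarrow> b \<in> A"
  shows "\<exists>\<theta> :: 'k mpoly \<Rightarrow> 'k mpoly. (\<forall>x y. \<theta> (x + y) = \<theta> x + \<theta> y) \<and> \<theta> 1 = 1 \<and>
      (\<forall>r g. Poly_Mapping.keys r \<subseteq> A \<longrightarrow> \<theta> (r ^ p ^ e * g) = r * \<theta> g) \<and>
      (\<forall>g. Poly_Mapping.keys (\<theta> g) \<subseteq> A)"
proof -
  define q where "q = p ^ e"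
  have q: "q > 0"
    using p prime_gt_0_nat by (simp add: q_def)
  obtain \<rho> :: "'k \<Rightarrow> 'k" where \<rho>_add: "\<And>x y. \<rho> (x + y) = \<rho> x + \<rho> y" and \<rho>_one: "\<rho> 1 = 1"
    and \<rho>_lin: "\<And>c x. \<rho> (c ^ q * x) = c * \<rho> x"
    using ex_inverse_Frobenius_linear[OF p] unfolding q_def by blast
  have \<rho>_zero: "\<rho> 0 = 0"
    using \<rho>_add[of 0 0] by (metis add.right_neutral add_left_cancel)
  have inj: "of_nat q * a = of_nat q * b \<longleftrightarrow> a = b" for a b :: "nat \<Rightarrow>\<^sub>0 nat"
    using q by (simp add: poly_mapping_eq_iff fun_eq_iff)
  define \<theta> :: "'k mpoly \<Rightarrow> 'k mpoly" where
    "\<theta> g = Poly_Mapping.Abs_poly_mapping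
      (\<lambda>b. if b \<in> A then \<rho> (Poly_Mapping.lookup g (of_nat q * b)) else 0)" for g
  have \<theta>: "Poly_Mapping.lookup (\<theta> g) b
      = (if b \<in> A then \<rho> (Poly_Mapping.lookup g (of_nat q * b)) else 0)" for g b
  proof -
    \<comment> \<open>Scaling by \<open>q > 0\<close> is injective, so the new coefficient function
      has finite support and \<open>Abs_poly_mapping\<close> represents it.\<close>
    have "finite ((\<lambda>b. of_nat q * b) -` Poly_Mapping.keys g)"
      by (rule finite_vimageI) (auto simp: inj_def inj)
    then have "finite {b. (if b \<in> A then \<rho> (Poly_Mapping.lookup g (of_nat q * b)) else 0) \<noteq> 0}"
      by (rule rev_finite_subset) (auto simp: \<rho>_zero in_keys_iff)
    then show ?thesis
      unfolding \<theta>_def by simp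
  qed
  have add: "\<theta> (x + y) = \<theta> x + \<theta> y" for x y
    by (rule poly_mapping_eqI) (simp add: \<theta> lookup_add \<rho>_add)
  have \<theta>_zero: "\<theta> 0 = 0"
    by (rule poly_mapping_eqI) (simp add: \<theta> \<rho>_zero)
  have \<theta>_sum: "\<theta> (sum f S) = (\<Sum>i\<in>S. \<theta> (f i))" for f and S :: "(nat \<Rightarrow>\<^sub>0 nat) set"
    by (induction S rule: infinite_finite_induct) (simp_all add: \<theta>_zero add)
  have \<theta>_single: "\<theta> (Poly_Mapping.single (of_nat q * b) c)
      = (if b \<in> A then Poly_Mapping.single b (\<rho> c) else 0)" for b c
    by (rule poly_mapping_eqI) (auto simp: \<theta> lookup_single when_def inj \<rho>_zero)
  have \<theta>_single_0: "\<theta> (Poly_Mapping.single a c) = 0"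
    if "\<And>b. a \<noteq> of_nat q * b" for a c
    by (rule poly_mapping_eqI) (simp add: \<theta> lookup_single when_def that \<rho>_zero)
  have monom: "\<theta> (Poly_Mapping.single (of_nat q * a) (\<alpha> ^ q) * Poly_Mapping.single c \<gamma>)
      = Poly_Mapping.single a \<alpha> * \<theta> (Poly_Mapping.single c \<gamma>)" if a: "a \<in> A" for a \<alpha> c \<gamma>
  proof (cases "\<exists>b. c = of_nat q * b")
    case True
    then obtain b where b: "c = of_nat q * b" ..
    \<comment> \<open>By \<open>full\<close>, the exponents \<open>b\<close> and
      \<open>a + b\<close> are both kept or both dropped.\<close>
    have "\<theta> (Poly_Mapping.single (of_nat q * (a + b)) (\<alpha> ^ q * \<gamma>))
        = Poly_Mapping.single a \<alpha> * \<theta> (Poly_Mapping.single c \<gamma>)"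
      using full[OF a] by (simp only: b \<theta>_single) (simp add: mult_single \<rho>_lin)
    then show ?thesis
      by (simp add: b mult_single distrib_left)
  next
    case False
    have "of_nat q * a + c \<noteq> of_nat q * b" for b
    proof
      assume *: "of_nat q * a + c = of_nat q * b"
      \<comment> \<open>The truncated subtraction is exact here, since \<open>q * b\<close>
        dominates \<open>q * a\<close> in each coordinate.\<close>
      have "Poly_Mapping.lookup c i = q * Poly_Mapping.lookup b i - q * Poly_Mapping.lookup a i" for i
        using arg_cong[OF *, of "\<lambda>f. Poly_Mapping.lookup f i"] by (simp add: lookup_add)
      then have "c = of_nat q * (b - a)"
        by (intro poly_mapping_eqI) (simp add: lookup_minus diff_mult_distrib2)
      then show False using False by blast
    qed
    then show ?thesis
      using False by (simp add: mult_single \<theta>_single_0)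
  qed
  have "\<theta> (r ^ q * g) = r * \<theta> g" if r: "Poly_Mapping.keys r \<subseteq> A" for r g
  proof -
    let ?r = "\<lambda>a. Poly_Mapping.single a (Poly_Mapping.lookup r a)"
    let ?rq = "\<lambda>a. Poly_Mapping.single (of_nat q * a) (Poly_Mapping.lookup r a ^ q)"
    let ?g = "\<lambda>c. Poly_Mapping.single c (Poly_Mapping.lookup g c)"
    have "\<theta> ((\<Sum>a\<in>Poly_Mapping.keys r. ?rq a) * (\<Sum>c\<in>Poly_Mapping.keys g. ?g c))
        = (\<Sum>a\<in>Poly_Mapping.keys r. \<Sum>c\<in>Poly_Mapping.keys g. \<theta> (?rq a * ?g c))"
      by (simp only: sum_product \<theta>_sum)
    also have "\<dots> = (\<Sum>a\<in>Poly_Mapping.keys r. \<Sum>c\<in>Poly_Mapping.keys g. ?r a * \<theta> (?g c))"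
      by (intro sum.cong refl monom) (use r in auto)
    also have "\<dots> = (\<Sum>a\<in>Poly_Mapping.keys r. ?r a) * \<theta> (\<Sum>c\<in>Poly_Mapping.keys g. ?g c)"
      by (simp only: sum_product \<theta>_sum)
    finally show ?thesis
      using mpoly_power_Frobenius[OF p, of r e]
      by (simp only: q_def poly_mapping_eq_sum_single[symmetric])
  qed
  moreover have "\<theta> 1 = 1"
    using \<theta>_single[of 0 1] zero by (simp add: \<rho>_one)
  moreover have "Poly_Mapping.keys (\<theta> g) \<subseteq> A" for g
    by (auto simp: in_keys_iff \<theta> split: if_splits)
  ultimately show ?thesis
    using add unfolding q_def by blast
qed

section \<open>The monomial algebra inside the Veronese ring\<close>

definition veronese_monoid :: "nat \<Rightarrow> nat \<Rightarrow> (nat \<Rightarrow>\<^sub>0 nat) set" where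
  "veronese_monoid n d =
    {a. Poly_Mapping.keys a \<subseteq> {..<n} \<and> d dvd (\<Sum>i<n. Poly_Mapping.lookup a i)}"

lemma keys_add_nat:
  "Poly_Mapping.keys (a + b :: nat \<Rightarrow>\<^sub>0 nat) = Poly_Mapping.keys a \<union> Poly_Mapping.keys b"
  by (auto simp: in_keys_iff lookup_add)

lemma veronese_monoid_zero: "0 \<in> veronese_monoid n d"
  by (simp add: veronese_monoid_def)

text \<open>The direction from left to right makes the projection onto \<open>k[A]\<close> linear
  over \<open>k[A]\<close>: a shift by an element of \<open>A\<close> never moves an outside
  exponent into \<open>A\<close>.\<close>

lemma veronese_monoid_add_iff:
  "a \<in> veronese_monoid n d \<Longrightarrow> a + b \<in> veronese_monoid n d \<longleftrightarrow> b \<in> veronese_monoid n d"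
  by (auto simp: veronese_monoid_def keys_add_nat lookup_add sum.distrib dvd_add_right_iff)

lemma monoid_gen_subset_veronese:
  assumes "U \<subseteq> T n d"
  shows "monoid_gen U \<subseteq> veronese_monoid n d"
proof -
  have "U \<subseteq> veronese_monoid n d"
    using assms by (auto simp: T_def veronese_monoid_def)
  then show ?thesis
    unfolding monoid_gen_def
    by (intro Inter_lower) (simp add: veronese_monoid_zero veronese_monoid_add_iff)
qed

lemma monoid_gen_zero: "0 \<in> monoid_gen U"
  and monoid_gen_base: "u \<in> U \<Longrightarrow> u \<in> monoid_gen U"
  and monoid_gen_add: "a \<in> monoid_gen U \<Longrightarrow> b \<in> monoid_gen U \<Longrightarrow> a + b \<in> monoid_gen U"
  unfolding monoid_gen_def by blast+

lemma monoid_gen_sum: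
  "(\<And>i. i \<in> S \<Longrightarrow> f i \<in> monoid_gen U) \<Longrightarrow> sum f S \<in> monoid_gen U"
  by (induction S rule: infinite_finite_induct) (auto intro: monoid_gen_zero monoid_gen_add)

lemma monoid_gen_of_nat_times: "a \<in> monoid_gen U \<Longrightarrow> of_nat q * a \<in> monoid_gen U"
  by (induction q) (auto simp: distrib_right intro: monoid_gen_zero monoid_gen_add)

lemma subring_of_monomial_algebra: "subring_of (monomial_algebra B :: 'k::field mpoly set)"
  unfolding monomial_algebra_def subring_of_def by blast

lemma single_in_monomial_algebra:
  assumes "u \<in> B"
  shows "Poly_Mapping.single u c \<in> (monomial_algebra B :: 'k::field mpoly set)"
proof -
  have "Poly_Mapping.single 0 c \<in> (monomial_algebra B :: 'k mpoly set)"
    "Poly_Mapping.single u 1 \<in> (monomial_algebra B :: 'k mpoly set)"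
    using assms unfolding monomial_algebra_def by blast+
  then have "Poly_Mapping.single 0 c * Poly_Mapping.single u 1 \<in> (monomial_algebra B :: 'k mpoly set)"
    using subring_of_monomial_algebra unfolding subring_of_def by blast
  then show ?thesis by (simp add: mult_single)
qed

lemma keys_monomial_algebra:
  assumes "B \<subseteq> A" "0 \<in> A" "\<And>a b. a \<in> A \<Longrightarrow> b \<in> A \<Longrightarrow> a + b \<in> A"
    and "f \<in> (monomial_algebra B :: 'k::field mpoly set)"
  shows "Poly_Mapping.keys f \<subseteq> A"
proof -
  let ?S = "{f :: 'k mpoly. Poly_Mapping.keys f \<subseteq> A}"
  have add: "f + g \<in> ?S" if "f \<in> ?S" "g \<in> ?S" for f g
    using that keys_add[of f g] by auto
  have diff: "f - g \<in> ?S" if "f \<in> ?S" "g \<in> ?S" for f g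
    using that by (auto simp: in_keys_iff lookup_minus subset_iff) (metis diff_zero)
  have mult: "f * g \<in> ?S" if "f \<in> ?S" "g \<in> ?S" for f g
    using that keys_mult[of f g] assms(3) by fastforce
  have "subring_of ?S"
    using add diff mult assms(2) by (simp add: subring_of_def)
  then have "monomial_algebra B \<subseteq> ?S"
    unfolding monomial_algebra_def using assms(1,2) by (intro Inter_lower) auto
  then show ?thesis using assms(4) by blast
qed

section \<open>Large multiples of Veronese exponents lie in the generated monoid\<close>

lemma T_maxexp_memI:
  assumes "{m \<in> T n d. maxexp n m \<ge> d - 1} \<subseteq> U"
    and "Poly_Mapping.keys a \<subseteq> {..<n}" "(\<Sum>i<n. Poly_Mapping.lookup a i) = d"
    and "i < n" "Poly_Mapping.lookup a i \<ge> d - 1"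
  shows "a \<in> U"
proof -
  have "Poly_Mapping.lookup a i \<le> maxexp n a"
    unfolding maxexp_def using assms(4) by (intro Max_ge) auto
  then show ?thesis
    using assms by (auto simp: T_def)
qed

text \<open>Subtracting \<open>(b j mod d) * ((d - 1) e_i + e_j)\<close> for all \<open>j \<noteq> i\<close> clears the residues
  modulo \<open>d\<close> in the other coordinates; the coordinate \<open>i\<close> is large enough to pay for it, and what
  it loses makes it divisible by \<open>d\<close> too.\<close>

lemma veronese_monoid_large_coord:
  assumes U: "{m \<in> T n d. maxexp n m \<ge> d - 1} \<subseteq> U"
    and d: "d > 0" and b: "b \<in> veronese_monoid n d"
    and i: "i < n" and large: "Poly_Mapping.lookup b i \<ge> (n - 1) * (d - 1) ^ 2"
  shows "b \<in> monoid_gen U"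
proof -
  let ?b = "Poly_Mapping.lookup b"
  let ?J = "{..<n} - {i}"
  \<comment> \<open>Both kinds of vectors have degree \<open>d\<close> and a coordinate at least
    \<open>d - 1\<close>, hence lie in \<open>U\<close>.\<close>
  define v where "v j = (Poly_Mapping.single j d :: nat \<Rightarrow>\<^sub>0 nat)" for j
  define w where "w j = (Poly_Mapping.single i (d - 1) + Poly_Mapping.single j 1 :: nat \<Rightarrow>\<^sub>0 nat)" for j
  define s where "s = (\<Sum>j\<in>?J. ?b j mod d)"
  have v: "v j \<in> monoid_gen U" if "j < n" for j
    by (rule monoid_gen_base, rule T_maxexp_memI[OF U, of _ j])
      (use that d in \<open>simp_all add: v_def lookup_single when_def\<close>)
  have w: "w j \<in> monoid_gen U" if "j \<in> ?J" for j
    by (rule monoid_gen_base, rule T_maxexp_memI[OF U, of _ i])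
      (use that d i in \<open>auto simp: w_def lookup_single lookup_add when_def sum.distrib keys_add_nat
        split: if_splits\<close>)
  \<comment> \<open>There are \<open>n - 1\<close> residues of size at most \<open>d - 1\<close>,
    and each unit of residue costs \<open>d - 1\<close> at coordinate \<open>i\<close>; this gives
    the threshold.\<close>
  have "s \<le> (\<Sum>j\<in>?J. d - 1)"
    unfolding s_def using d by (intro sum_mono) (simp add: less_eq_Suc_le[symmetric] Suc_le_lessD le_diff_conv2)
  then have "(d - 1) * s \<le> (d - 1) * ((n - 1) * (d - 1))"
    using i by simp
  also have "\<dots> = (n - 1) * (d - 1) ^ 2"
    by (simp only: power2_eq_square ac_simps)
  finally have s: "(d - 1) * s \<le> ?b i"
    using large by (rule order_trans)
  define t where "t = ?b i - (d - 1) * s"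
  have bi: "?b i = (d - 1) * s + t"
    using s by (simp add: t_def)
  have "(\<Sum>j<n. ?b j) = ?b i + (\<Sum>j\<in>?J. ?b j)"
    using i by (subst sum.remove[of _ i]) auto
  also have "(\<Sum>j\<in>?J. ?b j) = (\<Sum>j\<in>?J. d * (?b j div d)) + s"
    by (simp add: s_def flip: sum.distrib)
  \<comment> \<open>The cost \<open>(d - 1) * s\<close> and the residue sum \<open>s\<close> combine
    to \<open>d * s\<close>, so the total degree forces \<open>d\<close> to divide
    \<open>t\<close>.\<close>
  also have "?b i + \<dots> = t + d * (s + (\<Sum>j\<in>?J. ?b j div d))"
    using d by (cases d) (simp_all add: bi sum_distrib_left algebra_simps)
  finally have "d dvd t + d * (s + (\<Sum>j\<in>?J. ?b j div d))"
    using b by (simp add: veronese_monoid_def)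
  then have t: "d * (t div d) = t"
    by (simp add: dvd_add_left_iff)
  have "b = of_nat (t div d) * v i
      + (\<Sum>j\<in>?J. of_nat (?b j mod d) * w j + of_nat (?b j div d) * v j)" (is "_ = ?rhs")
  proof (rule poly_mapping_eqI)
    fix l
    have L: "Poly_Mapping.lookup ?rhs l = (t div d) * (d when i = l)
      + (\<Sum>j\<in>?J. (?b j mod d) * ((d - 1 when i = l) + (1 when j = l)) + (?b j div d) * (d when j = l))"
      by (simp add: lookup_add lookup_sum v_def w_def lookup_single)
    show "?b l = Poly_Mapping.lookup ?rhs l"
    proof (cases "l = i")
      case True
      have "(\<Sum>j\<in>?J. (?b j mod d) * ((d - 1 when i = l) + (1 when j = l)) + (?b j div d) * (d when j = l))
        = (\<Sum>j\<in>?J. (?b j mod d) * (d - 1))"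
        by (rule sum.cong) (auto simp: True when_def)
      then show ?thesis
        using t by (simp only: L) (simp add: True bi s_def sum_distrib_left mult.commute)
    next
      case False
      have "(\<Sum>j\<in>?J. (?b j mod d) * ((d - 1 when i = l) + (1 when j = l)) + (?b j div d) * (d when j = l))
        = (\<Sum>j\<in>?J. if j = l then ?b j else 0)"
        by (rule sum.cong) (use False in \<open>auto simp: when_def\<close>)
      also have "\<dots> = (if l < n then ?b l else 0)"
        using False by simp
      also have "\<dots> = ?b l"
        using b by (auto simp: veronese_monoid_def in_keys_iff subset_iff)
      finally show ?thesis
        using False by (simp only: L) simp
    qed
  qed
  moreover have "?rhs \<in> monoid_gen U"
    by (intro monoid_gen_add monoid_gen_sum monoid_gen_of_nat_times v w) (use i in auto)
  ultimately show ?thesis by simp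
qed

text \<open>A nonzero exponent vector has a coordinate at least 1, which scaling by \<open>N\<close>
  raises to the threshold.\<close>

lemma of_nat_times_veronese_monoid:
  assumes U: "{m \<in> T n d. maxexp n m \<ge> d - 1} \<subseteq> U"
    and d: "d > 0" and N: "N \<ge> (n - 1) * (d - 1) ^ 2" and a: "a \<in> veronese_monoid n d"
  shows "of_nat N * a \<in> monoid_gen U"
proof (cases "a = 0")
  case True
  then show ?thesis by (simp add: monoid_gen_zero)
next
  case False
  then have "Poly_Mapping.keys a \<noteq> {}" by simp
  then obtain i where i: "i \<in> Poly_Mapping.keys a" by blast
  then have "i < n" "Poly_Mapping.lookup a i \<ge> 1"
    using a by (auto simp: veronese_monoid_def Suc_le_eq in_keys_iff subset_iff)
  moreover have "of_nat N * a \<in> veronese_monoid n d"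
    using a by (auto simp: veronese_monoid_def in_keys_iff subset_iff simp flip: sum_distrib_left)
  ultimately show ?thesis
    using N mult_le_mono[of "(n - 1) * (d - 1) ^ 2" N 1 "Poly_Mapping.lookup a i"]
    by (intro veronese_monoid_large_coord[OF U d, of _ i]) simp_all
qed

section \<open>The logarithmic bound and the conclusion\<close>

lemma le_power_nat_ceiling_log:
  assumes "p \<ge> 2" "N > 0"
  shows "N \<le> p ^ nat \<lceil>log (real p) (real N)\<rceil>"
proof -
  have "real N = real p powr log (real p) (real N)"
    using assms by simp
  also have "\<dots> \<le> real p powr real (nat \<lceil>log (real p) (real N)\<rceil>)"
    using assms by (intro powr_mono) (auto intro: real_nat_ceiling_ge)
  also have "\<dots> = real (p ^ nat \<lceil>log (real p) (real N)\<rceil>)"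
    using assms by (subst powr_realpow) simp_all
  finally show ?thesis by (simp only: of_nat_le_iff)
qed

theorem theorem5p5:
  fixes U :: "(nat \<Rightarrow>\<^sub>0 nat) set" and n d p :: nat
  assumes "prime p" and "CHAR('k::field) = p" and "F_finite p TYPE('k)"
    and "n > 2" and "d > 2"
    and "{m \<in> T n d. maxexp n m \<ge> d - 1} \<subseteq> U" and "U \<subseteq> T n d"
  shows "Fte (monomial_algebra (monoid_gen U) :: 'k mpoly set) p
           \<le> enat (n * nat \<lceil>log (real p) (real ((n - 1) * (d ^ 2 - d)))\<rceil>)"
proof -
  let ?R = "monomial_algebra (monoid_gen U) :: 'k mpoly set"
  let ?A = "veronese_monoid n d"
  define m where "m = nat \<lceil>log (real p) (real ((n - 1) * (d ^ 2 - d)))\<rceil>"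
  note p = assms(1,2)
  have keys: "Poly_Mapping.keys f \<subseteq> ?A" if "f \<in> ?R" for f
    using keys_monomial_algebra[OF monoid_gen_subset_veronese[OF assms(7)] veronese_monoid_zero _ that]
      veronese_monoid_add_iff by blast
  obtain d' where d': "d = Suc d'" "d' > 0"
    using assms(5) by (cases d) auto
  have "(n - 1) * (d - 1) ^ 2 \<le> (n - 1) * (d ^ 2 - d)"
    by (rule mult_le_mono2) (simp add: d' power2_eq_square)
  also have "\<dots> \<le> p ^ m"
    unfolding m_def
    by (rule le_power_nat_ceiling_log)
      (use assms(4) d' prime_ge_2_nat[OF p(1)] in \<open>simp_all add: power2_eq_square\<close>)
  finally have N: "(n - 1) * (d - 1) ^ 2 \<le> p ^ m" .
  have power_mem: "f ^ p ^ m \<in> ?R" if f: "Poly_Mapping.keys f \<subseteq> ?A" for f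
    unfolding mpoly_power_Frobenius[OF p]
  proof (intro subring_of_sum[OF subring_of_monomial_algebra] single_in_monomial_algebra)
    fix a assume "a \<in> Poly_Mapping.keys f"
    then show "of_nat (p ^ m) * a \<in> monoid_gen U"
      using f d' by (intro of_nat_times_veronese_monoid[OF assms(6) _ N]) auto
  qed
  \<comment> \<open>The values of the splitting are supported in the Veronese monoid, so
    \<open>power_mem\<close> puts their \<open>p ^ m\<close>-th powers in the monomial
    algebra.\<close>
  have split: "\<exists>\<theta>. (\<forall>x y. \<theta> (x + y) = \<theta> x + \<theta> y) \<and> \<theta> 1 = 1 \<and>
      (\<forall>r\<in>?R. \<forall>g. \<theta> (r ^ p ^ e * g) = r * \<theta> g) \<and> (\<forall>g\<in>?R. \<theta> g ^ p ^ m \<in> ?R)" for e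
    using ex_Frobenius_splitting[OF p veronese_monoid_zero veronese_monoid_add_iff, of n d e]
      keys power_mem by metis
  have "Fte_ideal ?R p (ideal_gen ?R (set fs)) \<le> enat (n * m)" if fs: "full_hsop ?R fs" for fs
  proof -
    let ?q = "ideal_gen ?R (set fs)"
    have q: "ideal_in ?R ?q"
      using fs by (intro ideal_in_ideal_gen subring_of_monomial_algebra) (simp add: full_hsop_def)
    have "x ^ p ^ m \<in> frob_bracket ?R p m ?q" if "x \<in> frob_closure ?R p ?q" for x
      by (rule frob_closure_power_mem[OF subring_of_monomial_algebra q _ _ split that])
        (use p in \<open>simp_all add: CHAR_mpoly\<close>)
    then have eq: "frob_bracket ?R p m (frob_closure ?R p ?q) = frob_bracket ?R p m ?q"
      by (rule frob_bracket_frob_closure_eq[OF subring_of_monomial_algebra q])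
    then have "Fte_ideal ?R p ?q \<le> enat m"
      unfolding Fte_ideal_def by (auto intro: Least_le)
    also have "enat m \<le> enat (n * m)"
      using assms(4) by simp
    finally show ?thesis .
  qed
  then show ?thesis
    unfolding Fte_def m_def[symmetric] by (intro Sup_least) blast
qed

end
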